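(* Let $$q_n = \begin{cases} n\ln(n), & \mbox{if } n\mbox{ is even}, \\ (n-1)\ln(n), & \mbox{if } n\mbox{ is odd}. \end{cases}$$ If the inequality $$g_{n}< p_n\, \frac{q_{n+1}-q_n+1}{q_n}$$ holds for infinitely many even values of $n$, then the twin-prime conjecture is true, i.e. $g_n=2$ for infinitely many $n$.
   Context: $p_n$ denotes the $n$th prime number, and $g_n=p_{n+1}-p_n$ is the $n$th prime gap; $\ln$ is the natural logarithm. *)

theory Defs
  imports Complex_Main "HOL-Library.Infinite_Set" "HOL-Computational_Algebra.Primes"
begin

text \<open>
  Primes are indexed from 1, so \<open>nth_prime 1 = 2\<close>, whereas \<^const>\<open>enumerate\<close> counts from 0.
  The value at index 0 is junk.
\<close>

definition nth_prime :: "nat \<Rightarrow> nat" where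
  "nth_prime n = enumerate {p::nat. prime p} (n - 1)"

text \<open>For \<open>n \<ge> 1\<close> the subtraction does not truncate, since the primes are enumerated in
  increasing order.\<close>

definition prime_gap :: "nat \<Rightarrow> nat" where
  "prime_gap n = nth_prime (n + 1) - nth_prime n"

definition q :: "nat \<Rightarrow> real" where
  "q n = (if even n then real n * ln (real n) else (real n - 1) * ln (real n))"

end

theory Submission
  imports Defs "HOL-Real_Asymp.Real_Asymp"
begin

text \<open>
  For even \<open>n\<close>, \<open>q (n + 1) - q n = n ln (1 + 1/n) \<le> 1\<close>, so the hypothesis gives
  \<open>g\<^sub>n < 2 p\<^sub>n / (n ln n)\<close>. A prime gap beyond the first is even, so it suffices that
  \<open>p\<^sub>n \<le> 2 n ln n\<close> for large \<open>n\<close>: then \<open>g\<^sub>n < 4\<close>, whence \<open>g\<^sub>n = 2\<close>. This needs only a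
  Chebyshev bound with a constant below 2, and
  \<open>2 ^ (N - 1) \<le> lcm (1, \<dots>, N) \<le> N ^ \<pi>(N)\<close> yields the constant \<open>1 / ln 2 < 2\<close>.
  The lower bound holds because \<open>lcm (1, \<dots>, N)\<close> times any entry \<open>1 / ((n + 1) (n choose k))\<close>
  with \<open>n < N\<close> of Leibniz' harmonic triangle is an integer: the entries are iterated
  differences of the \<open>1 / j\<close>.
\<close>

section \<open>Upper bound for \<open>Lcm {1..N}\<close>\<close>

text \<open>The multiplicity of \<open>p\<close> in an lcm of two nonzero numbers is the larger of
  their multiplicities, so some single member carries the whole power.\<close>

lemma prime_power_dvd_Lcm_nat:
  fixes A :: "nat set"
  assumes "finite A" "0 \<notin> A" "prime p" "k > 0" "p ^ k dvd Lcm A"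
  shows "\<exists>a\<in>A. p ^ k dvd a"
  using assms
proof (induction A rule: finite_induct)
  case empty
  then show ?case by (auto simp: prime_gt_1_nat)
next
  case (insert a A)
  have np: "\<not> is_unit p" "Lcm A \<noteq> 0" "a \<noteq> 0"
    using insert.hyps insert.prems by (auto simp: Lcm_0_iff)
  have "k \<le> multiplicity p (lcm a (Lcm A))"
    using insert.prems np by (subst (asm) Lcm_insert) (auto simp: power_dvd_iff_le_multiplicity)
  then have "k \<le> multiplicity p a \<or> k \<le> multiplicity p (Lcm A)"
    using np insert.prems by (subst (asm) multiplicity_lcm) auto
  then have "p ^ k dvd a \<or> p ^ k dvd Lcm A"
    by (auto intro: multiplicity_dvd')
  then show ?case using insert by auto
qed

text \<open>Each full prime power in the lcm already divides one of \<open>1, ..., N\<close>, so it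
  contributes a factor of at most \<open>N\<close>, and only primes up to \<open>N\<close>
  occur.\<close>

lemma Lcm_atLeastAtMost_le_power:
  "Lcm {1..N} \<le> N ^ card {p. prime p \<and> p \<le> N}" for N :: nat
proof -
  define L where "L = Lcm {1..N}"
  have L: "L \<noteq> 0" by (auto simp: L_def Lcm_0_iff)
  have le: "p ^ multiplicity p L \<le> N \<and> p \<le> N" if "p \<in> prime_factors L" for p
  proof -
    have p: "prime p" and pos: "multiplicity p L > 0"
      using that L by (auto simp: prime_factors_multiplicity)
    obtain a where a: "a \<in> {1..N}" "p ^ multiplicity p L dvd a"
      using prime_power_dvd_Lcm_nat[of "{1..N}" p "multiplicity p L"] p pos
      by (auto simp: multiplicity_dvd L_def)
    then have "p ^ multiplicity p L \<le> N"
      by (meson atLeastAtMost_iff dvd_imp_le le_trans less_le_trans zero_less_one)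
    moreover have "p \<le> p ^ multiplicity p L"
      using p pos by (intro self_le_power) (auto dest: prime_ge_1_nat)
    ultimately show ?thesis by linarith
  qed
  have "L = (\<Prod>p\<in>prime_factors L. p ^ multiplicity p L)"
    using L by (simp add: prod_prime_factors)
  also have "\<dots> \<le> (\<Prod>p\<in>prime_factors L. N)"
    using le by (intro prod_mono) auto
  also have "\<dots> = N ^ card (prime_factors L)" by simp
  also have "\<dots> \<le> N ^ card {p. prime p \<and> p \<le> N}"
  \<comment> \<open>Powers of \<open>0\<close> are not increasing in the exponent, so
    \<open>N = 0\<close> is separate: both exponents are then \<open>0\<close>.\<close>
  proof (cases "N = 0")
    case False
    have "card (prime_factors L) \<le> card {p. prime p \<and> p \<le> N}"
      using le by (intro card_mono) auto
    then show ?thesis using False by (intro power_increasing) auto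
  next
    case True
    then have "{p. prime p \<and> p \<le> N} = {}" by auto
    moreover have "prime_factors L = {}" using True by (simp add: L_def)
    ultimately show ?thesis by (simp only: card.empty)
  qed
  finally show ?thesis by (simp add: L_def)
qed

section \<open>Lower bound for the lcm by Leibniz' harmonic triangle\<close>

text \<open>With \<open>A = (n + 1) (n choose k)\<close>, the reciprocals of the two binomials in
  row \<open>n + 1\<close> are \<open>(k + 1) / A\<close> and \<open>(n + 1 - k) / A\<close>, which
  add up to \<open>(n + 2) / A\<close>.\<close>

lemma inverse_binomial_harmonic_triangle:
  fixes n k :: nat
  assumes "k \<le> n"
  shows "1 / (real (n + 2) * real (Suc n choose Suc k)) =
    1 / (real (n + 1) * real (n choose k)) - 1 / (real (n + 2) * real (Suc n choose k))"
proof -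
  define A where "A = real (n + 1) * real (n choose k)"
  have A: "A > 0" using assms by (simp add: A_def)
  have pos: "real (Suc n choose Suc k) > 0" "real (Suc n choose k) > 0"
    using assms by (simp_all only: of_nat_0_less_iff zero_less_binomial_iff)
  have "real (Suc k) * real (Suc n choose Suc k) = A"
    using Suc_times_binomial[of k n] unfolding A_def by (metis Suc_eq_plus1 of_nat_mult)
  then have 1: "1 / real (Suc n choose Suc k) = real (Suc k) / A"
    using A pos by (simp add: field_simps)
  have "(Suc n - k) * (Suc n choose k) = Suc n * (n choose k)"
    using binomial_absorb_comp[of "Suc n" k] by simp
  then have "real (Suc n - k) * real (Suc n choose k) = A"
    unfolding A_def by (metis Suc_eq_plus1 of_nat_mult)
  then have 2: "1 / real (Suc n choose k) = real (Suc n - k) / A"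
    using A pos by (simp add: field_simps)
  have "1 / A = real (n + 2) / (real (n + 2) * A)" by simp
  also have "\<dots> = (real (Suc k) + real (Suc n - k)) / (real (n + 2) * A)"
    using assms by (simp add: of_nat_diff)
  also have "\<dots> =
      (1 / real (Suc n choose Suc k) + 1 / real (Suc n choose k)) / real (n + 2)"
    unfolding 1 2 by (simp add: add_divide_distrib mult.commute)
  finally show ?thesis unfolding A_def by (simp add: add_divide_distrib mult.commute)
qed

text \<open>Column 0 of the triangle consists of the \<open>1 / (n + 1)\<close>; each later column
  is obtained from differences in the previous one. Two adjacent rows are used, hence the induction
  with \<open>n\<close> arbitrary.\<close>

lemma Suc_times_binomial_dvd_in_Ints:
  fixes L :: nat
  assumes "\<And>j. j \<in> {1..N} \<Longrightarrow> j dvd L" "k \<le> n" "n < N"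
  shows "real L / (real (n + 1) * real (n choose k)) \<in> \<int>"
  using assms(2,3)
proof (induction k arbitrary: n)
  case 0
  then obtain c where "L = (n + 1) * c"
    using assms(1)[of "n + 1"] by (auto elim: dvdE)
  then have "real L / real (n + 1) = real c"
    by (simp only: of_nat_mult) (simp del: of_nat_add of_nat_Suc)
  then show ?case by simp
next
  case (Suc k)
  then obtain m where m: "n = Suc m" "k \<le> m" by (cases n) auto
  have "real L / (real (m + 2) * real (Suc m choose Suc k)) =
      real L / (real (m + 1) * real (m choose k)) - real L / (real (Suc m + 1) * real (Suc m choose k))"
    using arg_cong[OF inverse_binomial_harmonic_triangle[OF m(2)], of "\<lambda>x. real L * x"]
    by (simp add: right_diff_distrib)
  also have "\<dots> \<in> \<int>"
    using Suc.IH[of m] Suc.IH[of "Suc m"] Suc.prems m by (intro Ints_diff) auto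
  finally show ?case using m by simp
qed

text \<open>A positive integer is at least 1, so every \<open>(n + 1) (n choose k)\<close> is at
  most the lcm; summing over row \<open>n\<close> gives the power of 2.\<close>

lemma two_power_le_Lcm: "2 ^ n \<le> Lcm {1..Suc n}"
proof -
  define L where "L = Lcm {1..Suc n}"
  have "L \<noteq> 0" by (auto simp: L_def Lcm_0_iff)
  have le: "(n + 1) * (n choose k) \<le> L" if "k \<le> n" for k
  proof -
    have D: "real (n + 1) * real (n choose k) > 0" using that by simp
    have "real L / (real (n + 1) * real (n choose k)) \<in> \<int>"
      using that by (intro Suc_times_binomial_dvd_in_Ints[where N = "Suc n"]) (auto simp: L_def)
    moreover have "real L / (real (n + 1) * real (n choose k)) > 0"
      using D \<open>L \<noteq> 0\<close> by simp
    ultimately have "1 \<le> real L / (real (n + 1) * real (n choose k))"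
      by (metis Ints_nonzero_abs_ge1 abs_of_pos less_irrefl)
    then have "real (n + 1) * real (n choose k) \<le> real L" using D by (simp add: field_simps)
    then show ?thesis by (metis of_nat_le_iff of_nat_mult)
  qed
  have "(n + 1) * 2 ^ n = (\<Sum>k\<le>n. (n + 1) * (n choose k))"
    by (simp only: choose_row_sum sum_distrib_left[symmetric])
  also have "\<dots> \<le> (\<Sum>k\<le>n. L)" using le by (intro sum_mono) auto
  also have "\<dots> = (n + 1) * L" by simp
  finally have "2 ^ n \<le> L" by (subst (asm) mult_le_cancel1) simp
  then show ?thesis by (simp only: L_def)
qed

section \<open>Size of the \<open>n\<close>th prime\<close>

lemma prime_nth_prime: "prime (nth_prime n)"
  using enumerate_in_set[OF primes_infinite, of "n - 1"] by (simp add: nth_prime_def)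

lemma nth_prime_less_Suc: "n \<ge> 1 \<Longrightarrow> nth_prime n < nth_prime (n + 1)"
  by (simp add: nth_prime_def primes_infinite enumerate_mono)

lemma card_primes_le_nth_prime:
  assumes "n \<ge> 1"
  shows "card {p. prime p \<and> p \<le> nth_prime n} = n"
proof -
  let ?S = "{p::nat. prime p}"
  have "{p. prime p \<and> p \<le> nth_prime n} = enumerate ?S ` {..<n}"
  proof (intro equalityI subsetI)
    fix p assume p: "p \<in> {p. prime p \<and> p \<le> nth_prime n}"
    then obtain i where i: "enumerate ?S i = p"
      using enumerate_Ex[OF primes_infinite, of p] by auto
    then have "enumerate ?S i \<le> enumerate ?S (n - 1)" using p by (simp add: nth_prime_def)
    then have "i \<le> n - 1" by (simp only: enumerate_mono_le_iff[OF primes_infinite])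
    then show "p \<in> enumerate ?S ` {..<n}" using i assms by force
  next
    fix p assume "p \<in> enumerate ?S ` {..<n}"
    then obtain i where "i < n" "p = enumerate ?S i" by auto
    then show "p \<in> {p. prime p \<and> p \<le> nth_prime n}"
      using enumerate_in_set[OF primes_infinite, of i]
      by (auto simp: nth_prime_def primes_infinite)
  qed
  moreover have "inj_on (enumerate ?S) {..<n}"
    using inj_enumerate[OF primes_infinite] by (rule inj_on_subset) simp
  ultimately show ?thesis by (simp add: card_image)
qed

text \<open>Logarithm of the two lcm bounds at \<open>N = nth_prime n\<close>, where the number of
  primes up to \<open>N\<close> is exactly \<open>n\<close>.\<close>

lemma nth_prime_chebyshev:
  assumes "n \<ge> 1"
  shows "(real (nth_prime n) - 1) * ln 2 \<le> real n * ln (real (nth_prime n))"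
proof -
  define p where "p = nth_prime n"
  have p: "p \<ge> 2" unfolding p_def by (rule prime_ge_2_nat[OF prime_nth_prime])
  have "2 ^ (p - 1) \<le> p ^ n"
    using two_power_le_Lcm[of "p - 1"] Lcm_atLeastAtMost_le_power[of p]
      card_primes_le_nth_prime[OF assms] p
    by (simp add: p_def)
  then have "(2::real) ^ (p - 1) \<le> real p ^ n"
    by (metis of_nat_le_iff of_nat_numeral of_nat_power)
  then have "ln ((2::real) ^ (p - 1)) \<le> ln (real p ^ n)"
    using p by (subst ln_le_cancel_iff) auto
  then show ?thesis using p by (simp add: ln_realpow of_nat_diff p_def)
qed

text \<open>For large \<open>n\<close> the Chebyshev inequality fails at
  \<open>x = 2 n ln n\<close>. By concavity of \<open>ln\<close> it then fails at every larger
  point, so the prime cannot exceed \<open>x\<close>.\<close>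

lemma eventually_nth_prime_le:
  "\<forall>\<^sub>F n in sequentially. real (nth_prime n) \<le> 2 * real n * ln (real n)"
proof -
  have "(1::real) = ln (exp 1)" by simp
  also have "\<dots> < ln (2 ^ 2)" using exp_le by (subst ln_less_cancel_iff) auto
  also have "\<dots> = 2 * ln 2" by (subst ln_realpow) auto
  finally have ln2: "ln 2 > (1 / 2 :: real)" by simp
  \<comment> \<open>Divided by \<open>n ln n\<close>, the left side tends to
    \<open>2 ln 2 > 1\<close> and the right side to 1.\<close>
  have "\<forall>\<^sub>F n in sequentially.
      (2 * real n * ln (real n) - 1) * ln 2 > real n * ln (2 * real n * ln (real n))"
    using ln2 by real_asymp
  moreover have "\<forall>\<^sub>F n in sequentially. 2 * ln 2 * ln (real n) \<ge> 1"
    by real_asymp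
  moreover have "\<forall>\<^sub>F n in sequentially. n \<ge> (2::nat)"
    by (rule eventually_ge_at_top)
  ultimately show ?thesis
  proof eventually_elim
    case (elim n)
    define x where "x = 2 * real n * ln (real n)"
    define p where "p = real (nth_prime n)"
    have x: "x > 0" using elim by (simp add: x_def)
    have p: "p > 0" using prime_gt_0_nat[OF prime_nth_prime] by (simp add: p_def)
    show ?case
    proof (rule ccontr)
      assume "\<not> ?thesis"
      then have "x < p" by (simp add: x_def p_def)
      \<comment> \<open>At \<open>x\<close> the slope of \<open>n ln\<close> is at most the slope
        \<open>ln 2\<close> of the linear side.\<close>
      have nx: "real n / x \<le> ln 2"
        using elim x by (simp add: x_def field_simps)
      \<comment> \<open>The graph of \<open>ln\<close> lies below its tangent at
        \<open>x\<close>.\<close>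
      have "ln p = ln x + ln (p / x)" using p x by (simp add: ln_div)
      also have "\<dots> \<le> ln x + (p / x - 1)"
        using ln_le_minus_one[of "p / x"] p x by simp
      finally have "real n * ln p \<le> real n * (ln x + (p / x - 1))"
        by (intro mult_left_mono) auto
      moreover have "(p - 1) * ln 2 \<le> real n * ln p"
        using nth_prime_chebyshev[of n] elim by (simp add: p_def)
      ultimately have "(p - 1) * ln 2 \<le> real n * (ln x + (p / x - 1))" by linarith
      also have "\<dots> = real n * ln x + (p - x) * (real n / x)"
        using x by (simp add: field_simps)
      also have "\<dots> \<le> real n * ln x + (p - x) * ln 2"
        using nx \<open>x < p\<close> by (intro add_left_mono mult_left_mono) auto
      finally have "(x - 1) * ln 2 \<le> real n * ln x" by (simp add: algebra_simps)
      then show False using elim by (simp add: x_def)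
    qed
  qed
qed

section \<open>From the hypothesis on \<open>q\<close> to gaps equal to 2\<close>

text \<open>The odd branch gives \<open>q (n + 1)\<close> the factor \<open>n\<close> again, so only
  the logarithm changes.\<close>

lemma q_Suc_diff_le_1:
  assumes "even n" "n \<ge> 1"
  shows "q (n + 1) - q n \<le> 1"
proof -
  have "q (n + 1) - q n = real n * ln (real (n + 1) / real n)"
    using assms by (simp add: q_def ln_div algebra_simps)
  also have "real (n + 1) / real n = 1 + 1 / real n" using assms by (simp add: field_simps)
  also have "real n * ln (1 + 1 / real n) \<le> real n * (1 / real n)"
    using assms by (intro mult_left_mono ln_add_one_self_le_self) auto
  finally show ?thesis using assms by simp
qed

text \<open>From index 2 on both primes are odd; index 1 gives the gap \<open>3 - 2\<close>.\<close>

lemma even_prime_gap: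
  assumes "n \<ge> 2"
  shows "even (prime_gap n)"
proof -
  have "nth_prime 1 < nth_prime n"
    using assms by (simp add: nth_prime_def primes_infinite)
  then have "nth_prime n > 2" using prime_ge_2_nat[OF prime_nth_prime[of 1]] by linarith
  moreover have "nth_prime n < nth_prime (n + 1)" using assms by (intro nth_prime_less_Suc) auto
  ultimately show ?thesis
    using prime_odd_nat[OF prime_nth_prime, of n] prime_odd_nat[OF prime_nth_prime, of "n + 1"]
    by (auto simp: prime_gap_def)
qed

theorem mainTheorem4:
  assumes "infinite {n::nat. n \<ge> 1 \<and> even n \<and>
             real (prime_gap n) < real (nth_prime n) * ((q (n + 1) - q n + 1) / q n)}"
  shows "infinite {n::nat. n \<ge> 1 \<and> prime_gap n = 2}"
proof -
  obtain N where N: "\<And>n. n \<ge> N \<Longrightarrow> real (nth_prime n) \<le> 2 * real n * ln (real n)"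
    using eventually_nth_prime_le by (auto simp: eventually_sequentially)
  let ?A = "{n::nat. n \<ge> 1 \<and> even n \<and>
             real (prime_gap n) < real (nth_prime n) * ((q (n + 1) - q n + 1) / q n)}"
  have "?A - {..<N} \<subseteq> {n. n \<ge> 1 \<and> prime_gap n = 2}"
  proof
    fix n assume n: "n \<in> ?A - {..<N}"
    \<comment> \<open>Evenness excludes \<open>n = 1\<close>, where \<open>ln n\<close> vanishes and
      the gap is odd.\<close>
    then have n2: "n \<ge> 2" and ev: "even n" by (auto elim!: evenE)
    have q: "q n = real n * ln (real n)" "q n > 0" using ev n2 by (auto simp: q_def)
    have "(q (n + 1) - q n + 1) / q n \<le> 2 / q n"
      using q_Suc_diff_le_1[of n] ev n2 q by (intro divide_right_mono) auto
    then have "real (nth_prime n) * ((q (n + 1) - q n + 1) / q n) \<le> real (nth_prime n) * (2 / q n)"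
      by (intro mult_left_mono) auto
    \<comment> \<open>For even \<open>n\<close> the bound on the prime reads \<open>2 * q n\<close>,
      which cancels the denominator.\<close>
    also have "\<dots> \<le> (2 * q n) * (2 / q n)"
      using N[of n] n q by (intro mult_right_mono) auto
    also have "\<dots> = 4" using q(2) by simp
    finally have "real (prime_gap n) < 4" using n by auto
    then have "prime_gap n < 4" by simp
    moreover have "prime_gap n > 0" using nth_prime_less_Suc[of n] n2 by (simp add: prime_gap_def)
    moreover have "even (prime_gap n)" using n2 by (rule even_prime_gap)
    ultimately have "prime_gap n = 2" by presburger
    then show "n \<in> {n. n \<ge> 1 \<and> prime_gap n = 2}" using n2 by simp
  qed
  moreover have "infinite (?A - {..<N})" using assms by (intro Diff_infinite_finite) auto
  ultimately show ?thesis by (rule infinite_super)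
qed

end
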